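(* Suppose $\nabla f_t(x_t^* )=0$ for every $t\in\mathbb{Z}_{\ge0}$. Suppose there is a constant $G$ with $|\nabla f_t(x)|\le G$ for all $x\in\Theta$ and $t\in\mathbb{Z}_{>0}$, and there are $\mu>0$ and $L>0$ such that for all $t\in\mathbb{Z}_{\ge0}$ and $x,y\in\mathbb{R}^n$, $$f_t(y)\ge f_t(x)+\nabla f_t(x)^T(y-x)+\frac{\mu}{2}|y-x|^2,\qquad |\nabla f_t(x)-\nabla f_t(y)|\le L|x-y| .$$ If the stepsize is chosen as a constant $\alpha_t=\alpha\le\frac{2}{\mu+L}$, then the dynamic regret of the online random coordinate descent algorithm satisfies $$R_T^d\le\frac{G}{e}(C_T+C_1),$$ where $e=1-\sqrt{1-\frac{2\alpha}{P}\frac{\mu L}{\mu+L}}$, $C_T=\sum_{t=1}^T|x_t^*-x_{t-1}^*|$ and $C_1=\mathbb{E}\big[|x_1-x_1^*|\big]-|x_1^*-x_0^*|$.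
   Context: For each $t\in\mathbb{Z}_{\ge0}$, $f_t:\mathbb{R}^n\to\mathbb{R}$ is convex and continuously differentiable; $\Theta\subseteq\mathbb{R}^n$ is a non-empty closed convex set with Euclidean projection $\Pi_\Theta$; $|\cdot|$ is the Euclidean norm. The decision variable is partitioned into $P$ blocks, $x=(x_{(1)},\ldots,x_{(P)})$, $x_{(p)}\in\mathbb{R}^{n_p}$, $\sum_{p=1}^P n_p=n$, and $\nabla_{(p)}f_t$ denotes the $p$-th block of the gradient. Online random coordinate descent algorithm: start from $x_0\in\Theta$. At each time $t$ select $i_t\in\{1,\ldots,P\}$ uniformly at random (probability $1/P$ each), independently of all previous selections, and set $x_{t+1}=\Pi_\Theta\big(x_t-\alpha_tU_t\nabla f_t(x_t)\big)$, where $\alpha_t>0$ is the stepsize and $U_t$ is the block-diagonal matrix whose $i_t$-th diagonal block is the identity and whose other blocks are zero. $x_t^*\in\Theta$ denotes the minimizer of $f_t$ over $\Theta$. The dynamic regret is $R_T^d=\sum_{t=1}^T\mathbb{E}[f_t(x_t)]-\sum_{t=1}^T f_t(x_t^* )$. *)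

theory Defs
  imports "HOL-Probability.Probability"
begin

text \<open>
  The partition of the coordinates into \<open>P\<close> blocks is given by a map \<open>blk\<close> with values in
  \<open>{1..P}\<close>: coordinate \<open>j\<close> belongs to block \<open>blk j\<close>, so \<open>n\<^sub>p\<close> is the number
  of \<open>j\<close> with \<open>blk j = p\<close>. Up to the order in which coordinates are listed, the matrix
  below is block-diagonal, with the identity as its block \<open>p\<close> and zero blocks elsewhere.
\<close>

definition block_selector :: "('n::finite \<Rightarrow> nat) \<Rightarrow> nat \<Rightarrow> real ^ 'n ^ 'n" where
  "block_selector blk p = (\<chi> j k. if j = k \<and> blk j = p then 1 else 0)"

text \<open>
  One trajectory of the algorithm: \<open>\<alpha> t\<close>, \<open>g t\<close> and \<open>i t\<close> are the stepsize, the gradient of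
  the objective and the selected block at time \<open>t\<close>.
\<close>

primrec orcd ::
  "(real ^ 'n::finite) set \<Rightarrow> ('n \<Rightarrow> nat) \<Rightarrow> (nat \<Rightarrow> real) \<Rightarrow> (nat \<Rightarrow> real ^ 'n \<Rightarrow> real ^ 'n)
    \<Rightarrow> real ^ 'n \<Rightarrow> (nat \<Rightarrow> nat) \<Rightarrow> nat \<Rightarrow> real ^ 'n" where
  "orcd \<Theta> blk \<alpha> g x0 i 0 = x0"
| "orcd \<Theta> blk \<alpha> g x0 i (Suc t) =
     closest_point \<Theta> (orcd \<Theta> blk \<alpha> g x0 i t
       - \<alpha> t *\<^sub>R (block_selector blk (i t) *v g t (orcd \<Theta> blk \<alpha> g x0 i t)))"

definition dynamic_regret ::
  "'w measure \<Rightarrow> (nat \<Rightarrow> 'a \<Rightarrow> real) \<Rightarrow> (nat \<Rightarrow> 'w \<Rightarrow> 'a) \<Rightarrow> (nat \<Rightarrow> 'a) \<Rightarrow> nat \<Rightarrow> real" where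
  "dynamic_regret M f x xs T =
     (\<Sum>t=1..T. integral\<^sup>L M (\<lambda>\<omega>. f t (x t \<omega>))) - (\<Sum>t=1..T. f t (xs t))"

definition path_length :: "(nat \<Rightarrow> 'a::real_normed_vector) \<Rightarrow> nat \<Rightarrow> real" where
  "path_length xs T = (\<Sum>t=1..T. norm (xs t - xs (t - 1)))"

end

theory Submission
  imports Defs
begin

text \<open>
  The regret is controlled by the expected distances \<open>d\<^sub>t = \<bbbE>|x\<^sub>t - x\<^sub>t\<^sup>*|\<close>: by convexity and the
  gradient bound, \<open>f\<^sub>t(x\<^sub>t) - f\<^sub>t(x\<^sub>t\<^sup>*) \<le> G |x\<^sub>t - x\<^sub>t\<^sup>*|\<close>, so it suffices to bound \<open>\<Sum>\<^sub>t d\<^sub>t\<close>.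

  One step of the algorithm contracts the distance to the current minimizer in the mean. The
  projection is nonexpansive and fixes \<open>x\<^sub>t\<^sup>*\<close>; expanding the square of the unprojected step and
  averaging over the uniformly chosen block turns every block of the gradient into \<open>1/P\<close> times the
  full gradient, so the mean squared distance is at most
  \<open>|d|\<^sup>2 - (2\<alpha>/P) \<nabla>f\<^sub>t(x\<^sub>t) \<bullet> d + (\<alpha>\<^sup>2/P) |\<nabla>f\<^sub>t(x\<^sub>t)|\<^sup>2\<close> with \<open>d = x\<^sub>t - x\<^sub>t\<^sup>*\<close>. Since
  \<open>\<nabla>f\<^sub>t(x\<^sub>t\<^sup>*) = 0\<close>, the inequality \<open>strongly_convex_smooth_gradient_ineq\<close> bounds the inner product
  from below by a multiple of \<open>|d|\<^sup>2\<close> plus a multiple of \<open>|\<nabla>f\<^sub>t(x\<^sub>t)|\<^sup>2\<close>; for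
  \<open>\<alpha> \<le> 2/(\<mu>+L)\<close> the latter absorbs the last term, which leaves the factor
  \<open>q\<^sup>2 = 1 - (2\<alpha>/P) \<mu>L/(\<mu>+L)\<close>. The Cauchy-Schwarz inequality passes from squares to distances
  (\<open>mean_block_step_contraction\<close>).

  Because \<open>x\<^sub>t\<close> depends only on the blocks selected before time \<open>t\<close>, the block selected at time \<open>t\<close>
  is independent of it, and the average over blocks may be taken inside the expectation
  (\<open>expectation_independent_uniform\<close>). With the triangle inequality this gives
  \<open>d\<^sub>t\<^sub>+\<^sub>1 \<le> q d\<^sub>t + |x\<^sub>t\<^sub>+\<^sub>1\<^sup>* - x\<^sub>t\<^sup>*|\<close>, and summing this recursion
  (\<open>sum_le_of_perturbed_contraction\<close>) gives the bound with \<open>e = 1 - q\<close>.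
\<close>

section \<open>Smooth and strongly convex functions\<close>

text \<open>
  The difference of the two sides, restricted to the segment from \<open>y\<close> to \<open>z\<close>, has nonpositive
  derivative by the Lipschitz condition.
\<close>

lemma quadratic_upper_bound:
  fixes f :: "'a::real_inner \<Rightarrow> real"
  assumes grad: "\<And>y. GDERIV f y :> g y"
    and lip: "\<And>y z. norm (g y - g z) \<le> L * norm (y - z)"
  shows "f z \<le> f y + g y \<bullet> (z - y) + L / 2 * (norm (z - y))\<^sup>2"
proof -
  define v where "v = z - y"
  define \<phi> where "\<phi> s = f (y + s *\<^sub>R v) - s * (g y \<bullet> v) - L / 2 * s\<^sup>2 * (norm v)\<^sup>2" for s :: real
  have der: "(\<phi> has_real_derivative (g (y + s *\<^sub>R v) - g y) \<bullet> v - L * s * (norm v)\<^sup>2) (at s)" for s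
  proof -
    have f': "(f has_derivative (\<lambda>h. h \<bullet> g (y + s *\<^sub>R v))) (at (y + s *\<^sub>R v))"
      using grad[of "y + s *\<^sub>R v"] by (simp add: gderiv_def)
    have line: "((\<lambda>s. y + s *\<^sub>R v) has_derivative (\<lambda>h. h *\<^sub>R v)) (at s)"
      by (auto intro!: derivative_eq_intros)
    have "((\<lambda>s. f (y + s *\<^sub>R v)) has_derivative (\<lambda>h. (h *\<^sub>R v) \<bullet> g (y + s *\<^sub>R v))) (at s)"
      using has_derivative_compose[OF line f'] .
    then have 1: "((\<lambda>s. f (y + s *\<^sub>R v)) has_real_derivative g (y + s *\<^sub>R v) \<bullet> v) (at s)"
      by (simp add: has_field_derivative_def inner_commute[of v] mult_commute_abs)
    show ?thesis
      unfolding \<phi>_def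
      by (rule derivative_eq_intros 1 refl)+ (simp add: inner_diff_left)
  qed
  have "\<phi> 1 \<le> \<phi> 0"
  proof (rule DERIV_nonpos_imp_nonincreasing[of 0 1 \<phi>])
    fix s :: real assume s: "0 \<le> s" "s \<le> 1"
    have "(g (y + s *\<^sub>R v) - g y) \<bullet> v \<le> norm (g (y + s *\<^sub>R v) - g y) * norm v"
      by (rule norm_cauchy_schwarz)
    also have "\<dots> \<le> (L * norm (s *\<^sub>R v)) * norm v"
      using lip[of "y + s *\<^sub>R v" y] by (intro mult_right_mono) auto
    also have "\<dots> = L * s * (norm v)\<^sup>2"
      using s by (simp add: power2_eq_square)
    finally show "\<exists>d. (\<phi> has_real_derivative d) (at s) \<and> d \<le> 0"
      using der by fastforce
  qed simp
  then show ?thesis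
    by (simp add: \<phi>_def v_def)
qed

text \<open>
  Compare the lower bound based at \<open>y\<close> and the upper bound based at \<open>z\<close> in the point reached
  from \<open>z\<close> by going \<open>s\<close> times the difference of the gradients downwards. The step
  length \<open>s\<close> stays free so that the degenerate curvature \<open>K = 0\<close> is covered as well.
\<close>

lemma convexity_gap_ge_gradient_gap:
  fixes h :: "'a::real_inner \<Rightarrow> real"
  assumes lower: "\<And>y z. h z \<ge> h y + g y \<bullet> (z - y)"
    and upper: "\<And>y z. h z \<le> h y + g y \<bullet> (z - y) + K / 2 * (norm (z - y))\<^sup>2"
  shows "h z - h y - g y \<bullet> (z - y) \<ge> (s - K * s\<^sup>2 / 2) * (norm (g z - g y))\<^sup>2"
proof -
  define \<Delta> where "\<Delta> = g z - g y"
  define w where "w = z - s *\<^sub>R \<Delta>"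
  have "h y + g y \<bullet> (w - y) \<le> h z + g z \<bullet> (w - z) + K / 2 * (norm (w - z))\<^sup>2"
    using lower[of y w] upper[of w z] by simp
  moreover have "g y \<bullet> (w - y) = g y \<bullet> (z - y) - s * (g y \<bullet> \<Delta>)" "g z \<bullet> (w - z) = - s * (g z \<bullet> \<Delta>)"
    "K / 2 * (norm (w - z))\<^sup>2 = K / 2 * (s\<^sup>2 * (norm \<Delta>)\<^sup>2)"
    by (simp_all add: w_def inner_diff_right power_mult_distrib)
  moreover have "s * (norm \<Delta>)\<^sup>2 = s * (g z \<bullet> \<Delta>) - s * (g y \<bullet> \<Delta>)"
    by (simp add: \<Delta>_def power2_norm_eq_inner inner_diff_left right_diff_distrib)
  moreover have "(s - K * s\<^sup>2 / 2) * (norm \<Delta>)\<^sup>2 = s * (norm \<Delta>)\<^sup>2 - K / 2 * (s\<^sup>2 * (norm \<Delta>)\<^sup>2)"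
    by (simp add: algebra_simps)
  ultimately have "(s - K * s\<^sup>2 / 2) * (norm \<Delta>)\<^sup>2 \<le> h z - h y - g y \<bullet> (z - y)"
    by linarith
  then show ?thesis by (simp add: \<Delta>_def)
qed

text \<open>
  Adding the previous inequality to the one with \<open>y\<close> and \<open>z\<close> exchanged makes the function values
  cancel. The conclusion is stated without dividing by \<open>K\<close>: for \<open>K = 0\<close> it says
  that the gradient is constant, which arbitrarily large \<open>s\<close> shows.
\<close>

lemma cocoercive_gradient:
  fixes h :: "'a::real_inner \<Rightarrow> real"
  assumes lower: "\<And>y z. h z \<ge> h y + g y \<bullet> (z - y)"
    and upper: "\<And>y z. h z \<le> h y + g y \<bullet> (z - y) + K / 2 * (norm (z - y))\<^sup>2"
    and K: "K \<ge> 0"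
  shows "(norm (g z - g y))\<^sup>2 \<le> K * ((g z - g y) \<bullet> (z - y))"
proof -
  define a where "a = (g z - g y) \<bullet> (z - y)"
  define b where "b = (norm (g z - g y))\<^sup>2"
  have ab: "(2 * s - K * s\<^sup>2) * b \<le> a" for s
    using convexity_gap_ge_gradient_gap[OF lower upper, of s y z]
      convexity_gap_ge_gradient_gap[OF lower upper, of s z y]
    by (simp add: a_def b_def algebra_simps norm_minus_commute)
  have "b \<le> K * a"
  proof (cases "K = 0")
    case True
    have "b \<le> 0"
    proof (rule ccontr)
      assume "\<not> b \<le> 0"
      then show False
        using ab[of "(a + 1) / (2 * b)"] True by simp
    qed
    then show ?thesis using True by simp
  next
    case False
    then have "(1 / K) * b \<le> a"
      using ab[of "1 / K"] by (simp add: power2_eq_square)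
    then show ?thesis using False K by (simp add: field_simps)
  qed
  then show ?thesis by (simp add: a_def b_def)
qed

text \<open>
  Subtracting \<open>\<mu>/2 |u|\<^sup>2\<close> from \<open>f\<close> leaves a convex function whose quadratic upper bound has
  curvature \<open>L - \<mu>\<close>. Cocoercivity of its gradient \<open>g u - \<mu> u\<close>, expanded, is the claim.
\<close>

lemma strongly_convex_smooth_gradient_ineq:
  fixes f :: "'a::real_inner \<Rightarrow> real"
  assumes grad: "\<And>y. GDERIV f y :> g y"
    and strong: "\<And>y z. f z \<ge> f y + g y \<bullet> (z - y) + \<mu> / 2 * (norm (z - y))\<^sup>2"
    and lip: "\<And>y z. norm (g y - g z) \<le> L * norm (y - z)"
  shows "(norm (g z - g y))\<^sup>2 + \<mu> * L * (norm (z - y))\<^sup>2 \<le> (\<mu> + L) * ((g z - g y) \<bullet> (z - y))"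
proof (cases "z = y")
  case False
  define h where "h u = f u - \<mu> / 2 * (norm u)\<^sup>2" for u
  \<comment> \<open>The linearization error of \<open>h\<close> is that of \<open>f\<close> minus the one of the quadratic.\<close>
  have h_rem: "h v - h u - (g u - \<mu> *\<^sub>R u) \<bullet> (v - u) =
      f v - f u - g u \<bullet> (v - u) - \<mu> / 2 * (norm (v - u))\<^sup>2" for u v
    by (simp add: h_def power2_norm_eq_inner algebra_simps inner_diff inner_commute)
  have upper: "f v \<le> f u + g u \<bullet> (v - u) + L / 2 * (norm (v - u))\<^sup>2" for u v
    by (rule quadratic_upper_bound[OF grad lip])
  have "\<mu> / 2 * (norm (z - y))\<^sup>2 \<le> L / 2 * (norm (z - y))\<^sup>2"
    using strong[of y z] upper[of z y] by linarith
  then have "\<mu> \<le> L" using False by simp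
  have "(norm ((g z - \<mu> *\<^sub>R z) - (g y - \<mu> *\<^sub>R y)))\<^sup>2
      \<le> (L - \<mu>) * (((g z - \<mu> *\<^sub>R z) - (g y - \<mu> *\<^sub>R y)) \<bullet> (z - y))"
  proof (rule cocoercive_gradient[where h = h])
    show "h v \<ge> h u + (g u - \<mu> *\<^sub>R u) \<bullet> (v - u)" for u v
      using strong[of u v] h_rem[of v u] by linarith
    show "h v \<le> h u + (g u - \<mu> *\<^sub>R u) \<bullet> (v - u) + (L - \<mu>) / 2 * (norm (v - u))\<^sup>2" for u v
      using upper[of v u] h_rem[of v u] by (simp add: field_simps)
  qed (use \<open>\<mu> \<le> L\<close> in simp)
  moreover have "(g z - \<mu> *\<^sub>R z) - (g y - \<mu> *\<^sub>R y) = (g z - g y) - \<mu> *\<^sub>R (z - y)"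
    by (simp add: algebra_simps)
  moreover have "(norm ((g z - g y) - \<mu> *\<^sub>R (z - y)))\<^sup>2 =
      (norm (g z - g y))\<^sup>2 - 2 * \<mu> * ((g z - g y) \<bullet> (z - y)) + \<mu>\<^sup>2 * (norm (z - y))\<^sup>2"
    unfolding power2_norm_eq_inner inner_diff_left[of "g z - g y"] inner_diff_right[of _ "g z - g y"]
    by (simp add: inner_commute[of "z - y" "g z - g y"] power2_eq_square)
  moreover have "((g z - g y) - \<mu> *\<^sub>R (z - y)) \<bullet> (z - y) = (g z - g y) \<bullet> (z - y) - \<mu> * (norm (z - y))\<^sup>2"
    by (simp add: inner_diff_left[of "g z - g y"] power2_norm_eq_inner)
  ultimately have "(norm (g z - g y))\<^sup>2 - 2 * \<mu> * ((g z - g y) \<bullet> (z - y)) + \<mu>\<^sup>2 * (norm (z - y))\<^sup>2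
      \<le> (L - \<mu>) * ((g z - g y) \<bullet> (z - y) - \<mu> * (norm (z - y))\<^sup>2)"
    by simp
  then show ?thesis by (simp add: algebra_simps power2_eq_square)
qed simp

section \<open>One step of projected coordinate descent\<close>

lemma block_selector_mult:
  "block_selector blk p *v v = (\<chi> j. if blk j = p then v $ j else 0)"
  by (simp add: block_selector_def matrix_vector_mult_def vec_eq_iff if_distrib[of "\<lambda>c. c * _"]
      if_distribR cong: if_cong)

lemma inner_block_selector_self:
  "(block_selector blk p *v v) \<bullet> (block_selector blk p *v v) = (block_selector blk p *v v) \<bullet> v"
  unfolding block_selector_mult inner_vec_def by (intro sum.cong) auto

lemma sum_inner_block_selector:
  assumes "range blk \<subseteq> {1..P}"
  shows "(\<Sum>p=1..P. (block_selector blk p *v v) \<bullet> w) = v \<bullet> w"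
proof -
  have "(\<Sum>p=1..P. (block_selector blk p *v v) \<bullet> w)
      = (\<Sum>j\<in>UNIV. \<Sum>p=1..P. if p = blk j then v $ j * w $ j else 0)"
    unfolding block_selector_mult inner_vec_def by (subst sum.swap) (intro sum.cong, auto)
  also have "\<dots> = v \<bullet> w"
    using assms unfolding inner_vec_def by (intro sum.cong) (auto simp: image_subset_iff)
  finally show ?thesis .
qed

lemma norm_block_selector_le: "norm (block_selector blk p *v v) \<le> norm v"
  unfolding block_selector_mult norm_vec_def by (intro L2_set_mono) auto

definition block_step ::
  "(real ^ 'n::finite) set \<Rightarrow> ('n \<Rightarrow> nat) \<Rightarrow> real \<Rightarrow> (real ^ 'n \<Rightarrow> real ^ 'n) \<Rightarrow> nat
    \<Rightarrow> real ^ 'n \<Rightarrow> real ^ 'n" where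
  "block_step \<Theta> blk a g p y = closest_point \<Theta> (y - a *\<^sub>R (block_selector blk p *v g y))"

lemma orcd_Suc_block_step:
  "orcd \<Theta> blk \<alpha> g x0 i (Suc t) = block_step \<Theta> blk (\<alpha> t) (g t) (i t) (orcd \<Theta> blk \<alpha> g x0 i t)"
  by (simp add: block_step_def)

lemma norm_block_step_le:
  assumes \<Theta>: "closed \<Theta>" "convex \<Theta>" and c: "c \<in> \<Theta>"
  shows "norm (block_step \<Theta> blk a g p y - c) \<le> norm (y - a *\<^sub>R (block_selector blk p *v g y) - c)"
  using closest_point_lipschitz[OF \<Theta>(2,1), of "y - a *\<^sub>R (block_selector blk p *v g y)" c] c
    closest_point_self[OF c]
  by (auto simp: block_step_def dist_norm)

text \<open>
  Summing over the blocks reassembles \<open>g y\<close> from its blocks, in the inner product with \<open>y - c\<close> as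
  well as in the squared norm. The stepsize bound makes the term in \<open>|g y|\<^sup>2\<close> that \<open>ineq\<close>
  provides dominate the second-order term of the step. The hypothesis \<open>ineq\<close> is the conclusion of
  \<open>strongly_convex_smooth_gradient_ineq\<close> at a point \<open>c\<close> where the gradient vanishes.
\<close>

lemma mean_block_step_contraction:
  assumes \<Theta>: "closed \<Theta>" "convex \<Theta>" and c: "c \<in> \<Theta>"
    and blocks: "range blk \<subseteq> {1..P}" and P: "P > 0"
    and a: "a \<ge> 0" "a \<le> 2 / (\<mu> + L)" and pos: "\<mu> + L > 0"
    and ineq: "(norm (g y))\<^sup>2 + \<mu> * L * (norm (y - c))\<^sup>2 \<le> (\<mu> + L) * (g y \<bullet> (y - c))"
  shows "(\<Sum>p=1..P. norm (block_step \<Theta> blk a g p y - c)) / P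
    \<le> sqrt (1 - 2 * a / P * (\<mu> * L / (\<mu> + L))) * norm (y - c)"
proof -
  define N where "N p = norm (block_step \<Theta> blk a g p y - c)" for p
  define v where "v = g y"
  define d where "d = y - c"
  let ?U = "\<lambda>p. block_selector blk p *v v"
  have N2: "(N p)\<^sup>2 \<le> d \<bullet> d - 2 * a * (?U p \<bullet> d) + a\<^sup>2 * (?U p \<bullet> v)" for p
  proof -
    have "(N p)\<^sup>2 \<le> (norm (y - a *\<^sub>R ?U p - c))\<^sup>2"
      unfolding N_def v_def by (intro power_mono norm_block_step_le \<Theta> c) auto
    also have "y - a *\<^sub>R ?U p - c = d - a *\<^sub>R ?U p" by (simp add: d_def)
    also have "(norm (d - a *\<^sub>R ?U p))\<^sup>2 = d \<bullet> d - 2 * a * (?U p \<bullet> d) + a\<^sup>2 * (?U p \<bullet> ?U p)"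
      unfolding power2_norm_eq_inner
      by (simp add: inner_diff_left inner_diff_right inner_commute[of d "?U p"] power2_eq_square
          right_diff_distrib)
    finally show ?thesis by (simp add: inner_block_selector_self)
  qed
  have "(\<Sum>p=1..P. (N p)\<^sup>2)
      \<le> (\<Sum>p=1..P. d \<bullet> d - 2 * a * (?U p \<bullet> d) + a\<^sup>2 * (?U p \<bullet> v))"
    by (intro sum_mono N2)
  also have "\<dots> = P * (d \<bullet> d) - 2 * a * (v \<bullet> d) + a\<^sup>2 * (v \<bullet> v)"
    by (simp add: sum.distrib sum_subtractf sum_distrib_left[symmetric]
        sum_inner_block_selector[OF blocks] del: One_nat_def)
  also have "\<dots> \<le> P * (d \<bullet> d) - 2 * a * (\<mu> * L / (\<mu> + L)) * (d \<bullet> d)"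
  proof -
    have i1: "v \<bullet> d \<ge> (v \<bullet> v + \<mu> * L * (d \<bullet> d)) / (\<mu> + L)"
      using ineq pos by (simp add: v_def d_def power2_norm_eq_inner field_simps)
    have "a\<^sup>2 * (v \<bullet> v) \<le> a * (2 / (\<mu> + L)) * (v \<bullet> v)"
      unfolding power2_eq_square using a by (intro mult_right_mono mult_left_mono) auto
    moreover have "2 * a * ((v \<bullet> v + \<mu> * L * (d \<bullet> d)) / (\<mu> + L)) \<le> 2 * a * (v \<bullet> d)"
      using i1 a by (intro mult_left_mono) auto
    ultimately show ?thesis by (simp add: add_divide_distrib algebra_simps)
  qed
  finally have squares: "(\<Sum>p=1..P. (N p)\<^sup>2) \<le> P * (d \<bullet> d) - 2 * a * (\<mu> * L / (\<mu> + L)) * (d \<bullet> d)" .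
  have "(\<Sum>p=1..P. N p)\<^sup>2 \<le> P * (\<Sum>p=1..P. (N p)\<^sup>2)"
    using sum_squared_le_sum_of_squares[of N "{1..P}"] by (simp add: mult.commute)
  also have "\<dots> \<le> P * (P * (d \<bullet> d) - 2 * a * (\<mu> * L / (\<mu> + L)) * (d \<bullet> d))"
    using squares by (intro mult_left_mono) auto
  also have "\<dots> = (real P)\<^sup>2 * ((1 - 2 * a / P * (\<mu> * L / (\<mu> + L))) * (d \<bullet> d))"
  proof -
    have "P * (P * D - 2 * a * r * D) = (real P)\<^sup>2 * ((1 - 2 * a / P * r) * D)" for r D :: real
      using P by (simp add: power2_eq_square field_simps)
    then show ?thesis .
  qed
  finally have "((\<Sum>p=1..P. N p) / P)\<^sup>2 \<le> (1 - 2 * a / P * (\<mu> * L / (\<mu> + L))) * (d \<bullet> d)"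
    using P by (simp add: power_divide divide_le_eq mult.commute)
  then have "(\<Sum>p=1..P. N p) / P \<le> sqrt ((1 - 2 * a / P * (\<mu> * L / (\<mu> + L))) * (d \<bullet> d))"
    by (rule real_le_rsqrt)
  also have "\<dots> = sqrt (1 - 2 * a / P * (\<mu> * L / (\<mu> + L))) * norm d"
    by (simp add: real_sqrt_mult norm_eq_sqrt_inner)
  finally show ?thesis by (simp add: N_def d_def)
qed

text \<open>
  The upper bound comes from \<open>4\<mu>L \<le> (\<mu> + L)\<^sup>2\<close>; it keeps the radicand in the contraction factor
  nonnegative, and the lower bound makes the factor smaller than one.
\<close>

lemma contraction_factor_bounds:
  assumes \<mu>: "\<mu> > (0::real)" and L: "L > 0" and \<alpha>: "\<alpha> > 0" "\<alpha> \<le> 2 / (\<mu> + L)" and P: "P \<ge> (1::real)"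
  shows "0 < 2 * \<alpha> / P * (\<mu> * L / (\<mu> + L))" "2 * \<alpha> / P * (\<mu> * L / (\<mu> + L)) \<le> 1"
proof -
  show "0 < 2 * \<alpha> / P * (\<mu> * L / (\<mu> + L))" using assms by simp
  have "2 * \<alpha> / P * (\<mu> * L / (\<mu> + L)) \<le> 2 * \<alpha> / 1 * (\<mu> * L / (\<mu> + L))"
    using assms by (intro mult_right_mono divide_left_mono) auto
  also have "\<dots> \<le> 2 * (2 / (\<mu> + L)) / 1 * (\<mu> * L / (\<mu> + L))"
    using assms by (intro mult_right_mono divide_right_mono mult_left_mono) auto
  also have "\<dots> = 4 * \<mu> * L / (\<mu> + L)\<^sup>2" by (simp add: power2_eq_square)
  also have "\<dots> \<le> 1"
  proof -
    have "4 * \<mu> * L \<le> (\<mu> + L)\<^sup>2"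
      using zero_le_power2[of "\<mu> - L"] by (simp add: power2_eq_square algebra_simps)
    then show ?thesis using \<mu> L by simp
  qed
  finally show "2 * \<alpha> / P * (\<mu> * L / (\<mu> + L)) \<le> 1" .
qed

section \<open>Trajectories as random variables\<close>

lemma orcd_in:
  assumes "\<Theta> \<noteq> {}" "closed \<Theta>" "x0 \<in> \<Theta>"
  shows "orcd \<Theta> blk \<alpha> g x0 i t \<in> \<Theta>"
  using assms by (cases t) (auto intro: closest_point_in_set)

lemma orcd_cong:
  assumes "\<And>s. s < t \<Longrightarrow> i s = j s"
  shows "orcd \<Theta> blk \<alpha> g x0 i t = orcd \<Theta> blk \<alpha> g x0 j t"
  using assms by (induction t) auto

text \<open>
  A Lipschitz gradient that vanishes somewhere grows at most linearly, so one step can move the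
  iterate only by a bounded amount. Uniformity over all selections \<open>i\<close> makes the distances of the
  iterates to fixed points bounded, hence integrable, random variables.
\<close>

lemma orcd_bounded:
  assumes \<Theta>: "closed \<Theta>" "convex \<Theta>" and x0: "x0 \<in> \<Theta>"
    and zero: "\<And>t. g t (c t) = 0" and lip: "\<And>t y z. norm (g t y - g t z) \<le> L * norm (y - z)"
    and L: "0 \<le> L"
  shows "\<exists>B. \<forall>i. norm (orcd \<Theta> blk \<alpha> g x0 i t - x0) \<le> B"
proof (induction t)
  case 0
  show ?case by (auto intro: exI[of _ 0])
next
  case (Suc t)
  then obtain B where B: "\<And>i. norm (orcd \<Theta> blk \<alpha> g x0 i t - x0) \<le> B" by blast
  have "norm (orcd \<Theta> blk \<alpha> g x0 i (Suc t) - x0) \<le> B + \<bar>\<alpha> t\<bar> * (L * (B + norm (x0 - c t)))" for i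
  proof -
    define y where "y = orcd \<Theta> blk \<alpha> g x0 i t"
    have "norm (g t y) \<le> L * norm (y - c t)"
      using lip[of t y "c t"] by (simp add: zero)
    also have "\<dots> \<le> L * (B + norm (x0 - c t))"
      using B[of i] norm_triangle_ineq[of "y - x0" "x0 - c t"]
      by (intro mult_left_mono L) (auto simp: y_def)
    finally have gy: "norm (g t y) \<le> L * (B + norm (x0 - c t))" .
    have "norm (orcd \<Theta> blk \<alpha> g x0 i (Suc t) - x0) \<le> norm (y - \<alpha> t *\<^sub>R (block_selector blk (i t) *v g t y) - x0)"
      unfolding orcd_Suc_block_step y_def by (rule norm_block_step_le[OF \<Theta> x0])
    also have "\<dots> = norm ((y - x0) - \<alpha> t *\<^sub>R (block_selector blk (i t) *v g t y))"
      by (simp add: algebra_simps)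
    also have "\<dots> \<le> norm (y - x0) + \<bar>\<alpha> t\<bar> * norm (block_selector blk (i t) *v g t y)"
      using norm_triangle_ineq4[of "y - x0" "\<alpha> t *\<^sub>R (block_selector blk (i t) *v g t y)"] by simp
    also have "\<dots> \<le> B + \<bar>\<alpha> t\<bar> * (L * (B + norm (x0 - c t)))"
      using B[of i] order_trans[OF norm_block_selector_le gy]
      by (intro add_mono mult_left_mono) (auto simp: y_def)
    finally show ?thesis .
  qed
  then show ?case by blast
qed

lemma continuous_on_block_step:
  assumes "\<Theta> \<noteq> {}" "closed \<Theta>" "convex \<Theta>" "continuous_on UNIV g"
  shows "continuous_on UNIV (block_step \<Theta> blk a g p)"
proof -
  have "continuous_on UNIV (\<lambda>y. y - a *\<^sub>R (block_selector blk p *v g y))"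
    by (intro continuous_intros assms(4) matrix_vector_mult_linear_continuous_on
        continuous_on_compose2[OF matrix_vector_mult_linear_continuous_on assms(4)]) auto
  from continuous_on_compose2[OF continuous_on_closest_point[OF assms(3,2,1)] this]
  show ?thesis
    unfolding block_step_def by auto
qed

lemma measurable_orcd:
  assumes \<Theta>: "\<Theta> \<noteq> {}" "closed \<Theta>" "convex \<Theta>" and g: "\<And>t. continuous_on UNIV (g t)"
    and I: "{..<t} \<subseteq> I"
  shows "(\<lambda>i. orcd \<Theta> blk \<alpha> g x0 i t) \<in> borel_measurable (PiM I (\<lambda>_. count_space {1..P}))"
  using I
proof (induction t)
  case (Suc t)
  then have IH: "(\<lambda>i. orcd \<Theta> blk \<alpha> g x0 i t) \<in> borel_measurable (PiM I (\<lambda>_. count_space {1..P}))"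
    by (auto simp: lessThan_Suc)
  have t: "t \<in> I" using Suc.prems by auto
  show ?case
    unfolding orcd_Suc_block_step
  proof (rule measurable_compose_countable'[where I = "{1..P}" and g = "\<lambda>i. i t"
        and f = "\<lambda>p i. block_step \<Theta> blk (\<alpha> t) (g t) p (orcd \<Theta> blk \<alpha> g x0 i t)"])
    show "(\<lambda>i. block_step \<Theta> blk (\<alpha> t) (g t) p (orcd \<Theta> blk \<alpha> g x0 i t))
        \<in> borel_measurable (PiM I (\<lambda>_. count_space {1..P}))" for p
      by (rule measurable_compose[OF IH borel_measurable_continuous_onI[OF continuous_on_block_step[OF \<Theta> g]]])
    show "(\<lambda>i. i t) \<in> measurable (PiM I (\<lambda>_. count_space {1..P})) (count_space {1..P})"
      by (rule measurable_component_singleton[OF t])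
  qed auto
qed simp

text \<open>
  Split according to the value of the selection at time \<open>t\<close>: its indicator functions have
  expectation \<open>1/P\<close> and are independent of everything that is a function of the earlier selections.
\<close>

lemma (in prob_space) expectation_independent_uniform:
  fixes H :: "nat \<Rightarrow> (nat \<Rightarrow> nat) \<Rightarrow> real" and i :: "nat \<Rightarrow> 'a \<Rightarrow> nat"
  defines "X \<equiv> \<lambda>t \<omega>. restrict (\<lambda>s. i s \<omega>) {..<t}"
  assumes indep: "indep_vars (\<lambda>_. count_space {1..P}) i UNIV"
    and uni: "distr M (count_space {1..P}) (i t) = uniform_count_measure {1..P}"
    and H: "\<And>p. p \<in> {1..P} \<Longrightarrow> H p \<in> borel_measurable (PiM {..<t} (\<lambda>_. count_space {1..P}))"
    and int: "\<And>p. p \<in> {1..P} \<Longrightarrow> integrable M (\<lambda>\<omega>. H p (X t \<omega>))"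
  shows "expectation (\<lambda>\<omega>. H (i t \<omega>) (X t \<omega>)) = expectation (\<lambda>\<omega>. (\<Sum>p=1..P. H p (X t \<omega>)) / P)"
proof -
  have Y: "i t \<in> measurable M (count_space {1..P})"
    using indep by (auto simp: indep_vars_def)
  have split: "H (i t \<omega>) (X t \<omega>) = (\<Sum>p=1..P. indicator {p} (i t \<omega>) * H p (X t \<omega>))" if "\<omega> \<in> space M" for \<omega>
  proof -
    have "i t \<omega> \<in> {1..P}" using measurable_space[OF Y that] by simp
    then show ?thesis
      by (simp add: indicator_def if_distrib[of "\<lambda>c. c * _"] cong: if_cong)
  qed
  have ind_p: "indep_var borel (\<lambda>\<omega>. indicator {p} (i t \<omega>)) borel (\<lambda>\<omega>. H p (X t \<omega>))"
    if "p \<in> {1..P}" for p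
  proof -
    let ?S = "\<lambda>I. PiM I (\<lambda>_::nat. count_space {1..P})"
    have "indep_var (?S {t}) (\<lambda>\<omega>. restrict (\<lambda>s. i s \<omega>) {t}) (?S {..<t}) (X t)"
      unfolding X_def by (rule indep_var_restrict[OF indep]) auto
    moreover have "(\<lambda>h. indicator {p} (h t) :: real) \<in> borel_measurable (?S {t})"
      by (rule measurable_compose[OF measurable_component_singleton[of t]]) auto
    ultimately have "indep_var borel ((\<lambda>h. indicator {p} (h t)) \<circ> (\<lambda>\<omega>. restrict (\<lambda>s. i s \<omega>) {t})) borel (H p \<circ> X t)"
      using H[OF that] by (rule indep_var_compose)
    then show ?thesis by (simp add: comp_def)
  qed
  have int_ind: "integrable M (\<lambda>\<omega>. indicator {p} (i t \<omega>) :: real)" for p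
    by (rule integrable_const_bound[where B = 1])
       (auto simp: indicator_def intro!: measurable_compose[OF Y])
  have exp_ind: "expectation (\<lambda>\<omega>. indicator {p} (i t \<omega>)) = 1 / real P" if "p \<in> {1..P}" for p
  proof -
    have "expectation (\<lambda>\<omega>. indicator {p} (i t \<omega>) :: real)
        = integral\<^sup>L (distr M (count_space {1..P}) (i t)) (indicator {p})"
      by (rule integral_distr[OF Y, symmetric]) simp
    also have "\<dots> = measure (uniform_count_measure {1..P}) {p}"
      using that by (simp add: uni del: One_nat_def)
    also have "\<dots> = 1 / real P"
      using that by (subst measure_uniform_count_measure) auto
    finally show ?thesis .
  qed
  have int_p: "integrable M (\<lambda>\<omega>. indicator {p} (i t \<omega>) * H p (X t \<omega>))" if "p \<in> {1..P}" for p
    using indep_var_integrable[OF ind_p int_ind int] that by blast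
  have exp_p: "expectation (\<lambda>\<omega>. indicator {p} (i t \<omega>) * H p (X t \<omega>)) = 1 / P * expectation (\<lambda>\<omega>. H p (X t \<omega>))"
    if "p \<in> {1..P}" for p
    using indep_var_lebesgue_integral[OF ind_p int_ind int] exp_ind that by metis
  have "expectation (\<lambda>\<omega>. H (i t \<omega>) (X t \<omega>)) = expectation (\<lambda>\<omega>. \<Sum>p=1..P. indicator {p} (i t \<omega>) * H p (X t \<omega>))"
    by (intro Bochner_Integration.integral_cong refl split)
  also have "\<dots> = (\<Sum>p=1..P. expectation (\<lambda>\<omega>. indicator {p} (i t \<omega>) * H p (X t \<omega>)))"
    by (intro Bochner_Integration.integral_sum int_p)
  also have "\<dots> = (\<Sum>p=1..P. 1 / P * expectation (\<lambda>\<omega>. H p (X t \<omega>)))"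
    by (intro sum.cong refl exp_p)
  also have "\<dots> = expectation (\<lambda>\<omega>. (\<Sum>p=1..P. H p (X t \<omega>)) / P)"
    using int by (simp add: Bochner_Integration.integral_sum sum_divide_distrib)
  finally show "expectation (\<lambda>\<omega>. H (i t \<omega>) (X t \<omega>)) = expectation (\<lambda>\<omega>. (\<Sum>p=1..P. H p (X t \<omega>)) / P)" .
qed

section \<open>Summing the error recursion\<close>

text \<open>
  Induction on \<open>T\<close> requires keeping the term \<open>q * d T\<close> on the left-hand side. The subtracted \<open>c 1\<close>
  accounts for the recursion entering the sum only from the step from \<open>1\<close> to \<open>2\<close> on.
\<close>

lemma sum_le_of_perturbed_contraction:
  fixes d c :: "nat \<Rightarrow> real"
  assumes "\<And>t. d (Suc t) \<le> q * d t + c (Suc t)" "\<And>t. 0 \<le> d t" "0 \<le> q" "1 \<le> T"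
  shows "(1 - q) * (\<Sum>t=1..T. d t) \<le> (\<Sum>t=1..T. c t) + (d 1 - c 1)"
proof -
  have "(1 - q) * (\<Sum>t=1..T. d t) + q * d T \<le> (\<Sum>t=1..T. c t) + (d 1 - c 1)"
    using assms(4)
  proof (induction T rule: dec_induct)
    case (step n)
    then show ?case using assms(1)[of n] by (simp add: algebra_simps)
  qed (simp add: algebra_simps)
  moreover have "0 \<le> q * d T" using assms by simp
  ultimately show ?thesis by linarith
qed

theorem theorem4:
  fixes f :: "nat \<Rightarrow> real ^ 'n::finite \<Rightarrow> real"
    and g :: "nat \<Rightarrow> real ^ 'n \<Rightarrow> real ^ 'n"
    and \<Theta> :: "(real ^ 'n) set"
    and blk :: "'n \<Rightarrow> nat"
    and P T :: nat
    and M :: "'w measure"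
    and i :: "nat \<Rightarrow> 'w \<Rightarrow> nat"
    and x0 :: "real ^ 'n"
    and xs :: "nat \<Rightarrow> real ^ 'n"
    and x :: "nat \<Rightarrow> 'w \<Rightarrow> real ^ 'n"
    and G \<mu> L \<alpha> e C1 :: real
  assumes f_convex: "\<And>t. convex_on UNIV (f t)"
    and f_grad: "\<And>t y. GDERIV (f t) y :> g t y"
    and g_cont: "\<And>t. continuous_on UNIV (g t)"
    and \<Theta>: "\<Theta> \<noteq> {}" "closed \<Theta>" "convex \<Theta>"
    and blocks: "range blk \<subseteq> {1..P}"
    and prob: "prob_space M"
    and indep: "prob_space.indep_vars M (\<lambda>_. count_space {1..P}) i UNIV"
    and uniform: "\<And>t. distr M (count_space {1..P}) (i t) = uniform_count_measure {1..P}"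
    and x0: "x0 \<in> \<Theta>"
    and x_def: "x = (\<lambda>t \<omega>. orcd \<Theta> blk (\<lambda>_. \<alpha>) g x0 (\<lambda>s. i s \<omega>) t)"
    and xs: "\<And>t. is_arg_min (f t) (\<lambda>y. y \<in> \<Theta>) (xs t)"
    and grad_zero: "\<And>t. g t (xs t) = 0"
    and G: "\<And>t y. t > 0 \<Longrightarrow> y \<in> \<Theta> \<Longrightarrow> norm (g t y) \<le> G"
    and \<mu>: "\<mu> > 0"
    and L: "L > 0"
    and strong_convex: "\<And>t y z. f t z \<ge> f t y + g t y \<bullet> (z - y) + \<mu> / 2 * (norm (z - y))\<^sup>2"
    and lipschitz: "\<And>t y z. norm (g t y - g t z) \<le> L * norm (y - z)"
    and \<alpha>: "\<alpha> > 0" "\<alpha> \<le> 2 / (\<mu> + L)"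
    and e_def: "e = 1 - sqrt (1 - 2 * \<alpha> / real P * (\<mu> * L / (\<mu> + L)))"
    and C1_def: "C1 = integral\<^sup>L M (\<lambda>\<omega>. norm (x 1 \<omega> - xs 1)) - norm (xs 1 - xs 0)"
    and T: "T \<ge> 1"
  shows "dynamic_regret M f x xs T \<le> G / e * (path_length xs T + C1)"
proof -
  interpret prob_space M by (rule prob)
  define q where "q = sqrt (1 - 2 * \<alpha> / real P * (\<mu> * L / (\<mu> + L)))"
  define d where "d t = expectation (\<lambda>\<omega>. norm (x t \<omega> - xs t))" for t
  define X where "X t = (\<lambda>h. orcd \<Theta> blk (\<lambda>_. \<alpha>) g x0 h t)" for t
  define past where "past t = (\<lambda>\<omega>. restrict (\<lambda>s. i s \<omega>) {..<t})" for t :: nat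
  let ?S = "\<lambda>t. PiM {..<t} (\<lambda>_::nat. count_space {1..P})"
  have "1 \<le> P" using blocks by (auto simp: image_subset_iff intro: order_trans)
  have q: "0 \<le> q" "q < 1"
    using contraction_factor_bounds[OF \<mu> L \<alpha>, of P] \<open>1 \<le> P\<close> by (auto simp: q_def)
  have e: "e = 1 - q" "e > 0" using q by (auto simp: e_def q_def)
  have xs_in: "xs t \<in> \<Theta>" for t using xs[of t] by (simp add: is_arg_min_def)
  have x_in: "x t \<omega> \<in> \<Theta>" for t \<omega>
    unfolding x_def by (rule orcd_in[OF \<Theta>(1,2) x0])
  have x_past: "x t \<omega> = X t (past t \<omega>)" for t \<omega>
    unfolding x_def X_def past_def by (rule orcd_cong) simp
  have X_meas: "X t \<in> borel_measurable (?S t)" for t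
    unfolding X_def by (rule measurable_orcd[OF \<Theta> g_cont order_refl])
  have past_meas: "past t \<in> measurable M (?S t)" for t
    unfolding past_def using indep by (intro measurable_restrict) (auto simp: indep_vars_def)
  have x_meas: "x t \<in> borel_measurable M" for t
    using measurable_compose[OF past_meas X_meas] by (simp add: x_past[abs_def])
  have "\<exists>B. \<forall>h. norm (X t h - x0) \<le> B" for t
    unfolding X_def by (rule orcd_bounded[OF \<Theta>(2,3) x0 grad_zero lipschitz less_imp_le[OF L], of blk "\<lambda>_. \<alpha>"])
  then obtain B where B: "\<And>t h. norm (X t h - x0) \<le> B t" by metis
  have dist_int: "integrable M (\<lambda>\<omega>. norm (x t \<omega> - c))" for t c
  proof (rule integrable_const_bound[where B = "B t + norm (x0 - c)"])
    show "AE \<omega> in M. norm (norm (x t \<omega> - c)) \<le> B t + norm (x0 - c)"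
    proof (intro AE_I2)
      fix \<omega>
      show "norm (norm (x t \<omega> - c)) \<le> B t + norm (x0 - c)"
        using norm_triangle_ineq[of "x t \<omega> - x0" "x0 - c"] B[of t "past t \<omega>"] by (simp add: x_past)
    qed
  qed (use x_meas in measurable)

  have contraction: "expectation (\<lambda>\<omega>. norm (x (Suc t) \<omega> - xs t)) \<le> q * d t" for t
  proof -
    let ?H = "\<lambda>p h. norm (block_step \<Theta> blk \<alpha> (g t) p (X t h) - xs t)"
    have step: "x (Suc t) \<omega> = block_step \<Theta> blk \<alpha> (g t) (i t \<omega>) (x t \<omega>)" for \<omega>
      unfolding x_def by (rule orcd_Suc_block_step)
    have step_meas: "(\<lambda>h. block_step \<Theta> blk \<alpha> (g t) p (X t h)) \<in> borel_measurable (?S t)" for p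
      by (rule measurable_compose[OF X_meas
            borel_measurable_continuous_onI[OF continuous_on_block_step[OF \<Theta> g_cont]]])
    have H_meas: "?H p \<in> borel_measurable (?S t)" for p
      using step_meas by measurable
    have H_int: "integrable M (\<lambda>\<omega>. ?H p (past t \<omega>))" for p
    proof (rule integrable_const_bound[where B = "B (Suc t) + norm (x0 - xs t)"])
      show "AE \<omega> in M. norm (?H p (past t \<omega>)) \<le> B (Suc t) + norm (x0 - xs t)"
      proof (intro AE_I2)
        fix \<omega>
        let ?y = "block_step \<Theta> blk \<alpha> (g t) p (X t (past t \<omega>))"
        \<comment> \<open>A step with an arbitrary block \<open>p\<close> is an iterate of another selection sequence, so the
          uniform bound on iterates applies to it.\<close>
        let ?h = "(past t \<omega>)(t := p)"
        have "X (Suc t) ?h = block_step \<Theta> blk \<alpha> (g t) p (X t ?h)"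
          unfolding X_def orcd_Suc_block_step by simp
        also have "X t ?h = X t (past t \<omega>)"
          unfolding X_def by (rule orcd_cong) simp
        finally have "norm (?y - x0) \<le> B (Suc t)"
          using B[of "Suc t" ?h] by metis
        then show "norm (?H p (past t \<omega>)) \<le> B (Suc t) + norm (x0 - xs t)"
          using norm_triangle_ineq[of "?y - x0" "x0 - xs t"] by simp
      qed
      show "(\<lambda>\<omega>. ?H p (past t \<omega>)) \<in> borel_measurable M"
        by (rule measurable_compose[OF past_meas H_meas])
    qed
    have mean: "(\<Sum>p=1..P. ?H p (past t \<omega>)) / P \<le> q * norm (x t \<omega> - xs t)" for \<omega>
      unfolding q_def x_past[symmetric]
    proof (rule mean_block_step_contraction[OF \<Theta>(2,3) xs_in blocks])
      show "(norm (g t (x t \<omega>)))\<^sup>2 + \<mu> * L * (norm (x t \<omega> - xs t))\<^sup>2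
          \<le> (\<mu> + L) * (g t (x t \<omega>) \<bullet> (x t \<omega> - xs t))"
        using strongly_convex_smooth_gradient_ineq[OF f_grad strong_convex lipschitz, of t "x t \<omega>" "xs t"]
        by (simp add: grad_zero)
    qed (use \<open>1 \<le> P\<close> \<alpha> \<mu> L in auto)
    have "expectation (\<lambda>\<omega>. norm (x (Suc t) \<omega> - xs t)) = expectation (\<lambda>\<omega>. ?H (i t \<omega>) (past t \<omega>))"
      by (simp only: step flip: x_past)
    also have "\<dots> = expectation (\<lambda>\<omega>. (\<Sum>p=1..P. ?H p (past t \<omega>)) / P)"
      unfolding past_def
      by (rule expectation_independent_uniform[where H = ?H, OF indep uniform H_meas H_int[unfolded past_def]])
    also have "\<dots> \<le> expectation (\<lambda>\<omega>. q * norm (x t \<omega> - xs t))"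
      by (intro integral_mono mean) (use H_int dist_int in auto)
    also have "\<dots> = q * d t" by (simp add: d_def)
    finally show ?thesis .
  qed

  have recursion: "d (Suc t) \<le> q * d t + norm (xs (Suc t) - xs t)" for t
  proof -
    have "d (Suc t) \<le> expectation (\<lambda>\<omega>. norm (x (Suc t) \<omega> - xs t) + norm (xs (Suc t) - xs t))"
      unfolding d_def
    proof (rule integral_mono)
      fix \<omega>
      show "norm (x (Suc t) \<omega> - xs (Suc t)) \<le> norm (x (Suc t) \<omega> - xs t) + norm (xs (Suc t) - xs t)"
        using norm_triangle_ineq4[of "x (Suc t) \<omega> - xs t" "xs (Suc t) - xs t"] by simp
    qed (use dist_int in auto)
    also have "\<dots> = expectation (\<lambda>\<omega>. norm (x (Suc t) \<omega> - xs t)) + norm (xs (Suc t) - xs t)"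
      using dist_int by (simp add: prob_space)
    finally show ?thesis using contraction[of t] by linarith
  qed
  have d_nonneg: "0 \<le> d t" for t unfolding d_def by simp
  have "(1 - q) * (\<Sum>t=1..T. d t)
      \<le> (\<Sum>t=1..T. norm (xs t - xs (t - 1))) + (d 1 - norm (xs 1 - xs (1 - 1)))"
    by (rule sum_le_of_perturbed_contraction[OF _ d_nonneg q(1) T]) (simp add: recursion)
  then have "e * (\<Sum>t=1..T. d t) \<le> path_length xs T + C1"
    by (simp add: e(1) path_length_def C1_def d_def)
  then have sum_d: "(\<Sum>t=1..T. d t) \<le> (path_length xs T + C1) / e"
    by (simp add: pos_le_divide_eq[OF e(2)] mult.commute)

  have regret: "expectation (\<lambda>\<omega>. f t (x t \<omega>)) \<le> f t (xs t) + G * d t" if "t \<ge> 1" for t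
  proof -
    have gap: "f t (xs t) \<le> f t (x t \<omega>)" "f t (x t \<omega>) \<le> f t (xs t) + G * norm (x t \<omega> - xs t)" for \<omega>
    proof -
      show "f t (xs t) \<le> f t (x t \<omega>)"
        using xs[of t] x_in[of t \<omega>] by (auto simp: is_arg_min_linorder)
      have "g t (x t \<omega>) \<bullet> (x t \<omega> - xs t) \<le> norm (g t (x t \<omega>)) * norm (x t \<omega> - xs t)"
        by (rule norm_cauchy_schwarz)
      also have "\<dots> \<le> G * norm (x t \<omega> - xs t)"
        using G[OF _ x_in] that by (intro mult_right_mono) auto
      finally have "g t (x t \<omega>) \<bullet> (x t \<omega> - xs t) \<le> G * norm (x t \<omega> - xs t)" .
      moreover have "0 \<le> \<mu> / 2 * (norm (xs t - x t \<omega>))\<^sup>2" using \<mu> by simp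
      ultimately show "f t (x t \<omega>) \<le> f t (xs t) + G * norm (x t \<omega> - xs t)"
        using strong_convex[of t "x t \<omega>" "xs t"] by (simp add: inner_diff_right)
    qed
    have "continuous_on UNIV (f t)"
      using f_grad by (auto simp: gderiv_def continuous_on_eq_continuous_at dest: has_derivative_continuous)
    then have meas: "(\<lambda>\<omega>. f t (x t \<omega>)) \<in> borel_measurable M"
      by (intro measurable_compose[OF x_meas] borel_measurable_continuous_onI)
    \<comment> \<open>The expectation is a genuine one: \<open>gap\<close> encloses \<open>f t (x t \<omega>)\<close> between integrable functions.\<close>
    have bound_int: "integrable M (\<lambda>\<omega>. \<bar>f t (xs t)\<bar> + G * norm (x t \<omega> - xs t))"
      using dist_int by auto
    have "integrable M (\<lambda>\<omega>. f t (x t \<omega>))"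
    proof (rule Bochner_Integration.integrable_bound[OF bound_int meas AE_I2])
      fix \<omega>
      show "norm (f t (x t \<omega>)) \<le> norm (\<bar>f t (xs t)\<bar> + G * norm (x t \<omega> - xs t))"
        using gap[of \<omega>] by simp
    qed
    then have "expectation (\<lambda>\<omega>. f t (x t \<omega>)) \<le> expectation (\<lambda>\<omega>. f t (xs t) + G * norm (x t \<omega> - xs t))"
      using gap dist_int by (intro integral_mono) auto
    then show ?thesis using dist_int by (simp add: d_def prob_space)
  qed

  have "0 \<le> G" using G[of 1 x0] x0 norm_ge_zero[of "g 1 x0"] by linarith
  have "(\<Sum>t=1..T. expectation (\<lambda>\<omega>. f t (x t \<omega>))) \<le> (\<Sum>t=1..T. f t (xs t) + G * d t)"
    by (intro sum_mono regret) auto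
  then have "dynamic_regret M f x xs T \<le> G * (\<Sum>t=1..T. d t)"
    by (simp add: dynamic_regret_def sum.distrib sum_distrib_left)
  also have "\<dots> \<le> G * ((path_length xs T + C1) / e)"
    using sum_d \<open>0 \<le> G\<close> by (intro mult_left_mono)
  finally show ?thesis by simp
qed

end
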